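(* Let $G$ be a connected simple graph with $n\ge 2$ vertices and $m$ edges, with maximum vertex degree $\Delta(G)$ and minimum vertex degree $\delta(G)$, and let $q_1\ge\dots\ge q_n\ge 0$ be its signless Laplacian eigenvalues, $S^+_k(G)=\sum_{i=1}^k q_i$. If $1\le k\le n-1$, then $$S^+_k(G)\le \frac{2mk}{n}+\frac{\sqrt{mk(n-k)\big(2\Delta(G)\delta(G)(n-2m)+m(\Delta(G)+\delta(G))^2\big)}}{n\sqrt{\Delta(G)\delta(G)}},$$ with equality if and only if $G\cong K_n$ and $k=1$. Moreover, for $k=n$ equality always holds (both sides equal $2m$).
   Context: The signless Laplacian matrix of $G$ is $Q(G)=D(G)+A(G)$, where $A(G)$ is the adjacency matrix and $D(G)$ the diagonal matrix of vertex degrees. $K_n$ is the complete graph on $n$ vertices. *)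

theory Defs
  imports
    Complex_Main
    "Jordan_Normal_Form.Char_Poly"
    "Graph_Theory.Digraph_Component"
    "Graph_Theory.Kuratowski"
begin

text \<open>
  Graphs follow the convention of theory Digraph: a finite simple graph is a finite loop-free
  symmetric digraph without parallel arcs (locale \<^locale>\<open>graph\<close>). Every edge is thus a
  pair of opposite arcs, and the degree of a vertex is its out-degree.
\<close>

definition num_edges :: "('a, 'b) pre_digraph \<Rightarrow> nat" where
  "num_edges G = card ((\<lambda>e. {tail G e, head G e}) ` arcs G)"

definition max_degree :: "('a, 'b) pre_digraph \<Rightarrow> nat" where
  "max_degree G = Max (out_degree G ` verts G)"

definition min_degree :: "('a, 'b) pre_digraph \<Rightarrow> nat" where
  "min_degree G = Min (out_degree G ` verts G)"

text \<open>
  The matrices of a graph are taken with respect to an ordering \<open>vs\<close> of its vertices, i.e. a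
  list containing every vertex exactly once.
\<close>

definition adjacency_matrix :: "('a, 'b) pre_digraph \<Rightarrow> 'a list \<Rightarrow> real mat" where
  "adjacency_matrix G vs =
     mat (length vs) (length vs) (\<lambda>(i, j). if vs ! i \<rightarrow>\<^bsub>G\<^esub> vs ! j then 1 else 0)"

definition degree_matrix :: "('a, 'b) pre_digraph \<Rightarrow> 'a list \<Rightarrow> real mat" where
  "degree_matrix G vs = mat_diag (length vs) (\<lambda>i. real (out_degree G (vs ! i)))"

definition signless_laplacian :: "('a, 'b) pre_digraph \<Rightarrow> 'a list \<Rightarrow> real mat" where
  "signless_laplacian G vs = degree_matrix G vs + adjacency_matrix G vs"

text \<open>
  The eigenvalues in non-increasing order, repeated according to multiplicity. The signless
  Laplacian is real symmetric, so its characteristic polynomial splits over the reals and the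
  list has as many entries as the graph has vertices.
\<close>

definition signless_eigenvalues :: "('a, 'b) pre_digraph \<Rightarrow> 'a list \<Rightarrow> real list" where
  "signless_eigenvalues G vs =
     rev (sorted_list_of_multiset (proots (char_poly (signless_laplacian G vs))))"

definition signless_sum :: "('a, 'b) pre_digraph \<Rightarrow> 'a list \<Rightarrow> nat \<Rightarrow> real" where
  "signless_sum G vs k = sum_list (take k (signless_eigenvalues G vs))"

end

theory Submission
  imports Defs "Jordan_Normal_Form.Schur_Decomposition"
begin

text \<open>
  Write \<open>d v\<close> for the degrees and \<open>q i\<close> for the eigenvalues. Then \<open>\<Sum> q i = 2 m\<close> and
  \<open>\<Sum> (q i)\<^sup>2 = \<Sum> (d v)\<^sup>2 + 2 m\<close>, both read off as traces. Cauchy--Schwarz on the \<open>k\<close> largest and the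
  remaining \<open>n - k\<close> eigenvalues bounds \<open>(n S - 2 m k)\<^sup>2\<close> by \<open>k (n - k) (n \<Sum> (q i)\<^sup>2 - 4 m\<^sup>2)\<close>, and the
  Polya--Szego inequality bounds \<open>n \<Sum> (d v)\<^sup>2\<close> by \<open>m\<^sup>2 (\<Delta> + \<delta>)\<^sup>2 / (\<Delta> \<delta>)\<close>.

  Equality forces at most two distinct eigenvalues, so \<open>Q\<^sup>2\<close> is a combination of \<open>Q\<close> and the identity.
  Comparing off-diagonal entries, two non-adjacent vertices have no common neighbour; by connectedness
  the graph is complete. There \<open>q 1 = 2 (n - 1)\<close>, since the bound for \<open>k = 1\<close> is attained by the
  all-ones vector, and equality for larger \<open>k\<close> contradicts the value of the bound.
\<close>

subsection \<open>Traces and eigenvalues of real symmetric matrices\<close>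

definition trace :: "'a::comm_monoid_add mat \<Rightarrow> 'a" where
  "trace A = (\<Sum>i<dim_row A. A $$ (i, i))"

lemma index_mult_mat_sum:
  assumes "A \<in> carrier_mat nr n" "B \<in> carrier_mat n nc" "i < nr" "j < nc"
  shows "(A * B) $$ (i, j) = (\<Sum>l<n. A $$ (i, l) * B $$ (l, j))"
  using assms by (auto simp: scalar_prod_def atLeast0LessThan intro!: sum.cong)

lemma trace_mult_comm:
  fixes A B :: "'a::comm_semiring_0 mat"
  assumes A: "A \<in> carrier_mat n m" and B: "B \<in> carrier_mat m n"
  shows "trace (A * B) = trace (B * A)"
proof -
  have "trace (A * B) = (\<Sum>i<n. \<Sum>j<m. A $$ (i, j) * B $$ (j, i))"
    unfolding trace_def using A B by (intro sum.cong) (auto simp: index_mult_mat_sum[OF A B] simp del: index_mult_mat(1))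
  also have "\<dots> = (\<Sum>j<m. \<Sum>i<n. B $$ (j, i) * A $$ (i, j))"
    by (subst sum.swap) (simp add: mult.commute)
  also have "\<dots> = trace (B * A)"
    unfolding trace_def using A B by (intro sum.cong) (auto simp: index_mult_mat_sum[OF B A] simp del: index_mult_mat(1))
  finally show ?thesis .
qed

lemma trace_similar:
  fixes A :: "'a::comm_semiring_1 mat"
  assumes A: "A \<in> carrier_mat n n" and sim: "similar_mat_wit A B P Q"
  shows "trace A = trace B"
proof -
  note w = similar_mat_witD2[OF A sim]
  have "trace A = trace (P * (B * Q))" using w by simp
  also have "\<dots> = trace (B * Q * P)" by (rule trace_mult_comm) (use w in auto)
  also have "\<dots> = trace B" using w by simp
  finally show ?thesis .
qed

text \<open>The inner \<open>Q * P\<close> cancels. Keeping the witnesses explicit lets one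
  triangularisation serve every product of shifted copies of a matrix.\<close>

lemma similar_mat_wit_mult:
  assumes A: "A \<in> carrier_mat n n" "A' \<in> carrier_mat n n"
    and sim: "similar_mat_wit A B P Q" and sim': "similar_mat_wit A' B' P Q"
  shows "similar_mat_wit (A * A') (B * B') P Q"
proof -
  note w = similar_mat_witD2[OF A(1) sim]
  note w' = similar_mat_witD2[OF A(2) sim']
  note assoc = assoc_mult_mat[of _ n n _ n _ n]
  have "A * A' = P * B * (Q * (P * (B' * Q)))"
    unfolding w(3) w'(3) using w(5-7) w'(5) by (simp add: assoc)
  also have "Q * (P * (B' * Q)) = (Q * P) * (B' * Q)"
    using w(5-7) w'(5) by (simp add: assoc)
  also have "P * B * \<dots> = P * (B * B') * Q"
    unfolding w(2) using w(5-7) w'(5) by (simp add: assoc)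
  finally show ?thesis
    using w w' A by (intro similar_mat_witI[of _ _ n]) auto
qed

lemma similar_mat_wit_add_scalar:
  fixes A :: "'a::comm_ring_1 mat"
  assumes A: "A \<in> carrier_mat n n" and sim: "similar_mat_wit A B P Q"
  shows "similar_mat_wit (A + c \<cdot>\<^sub>m 1\<^sub>m n) (B + c \<cdot>\<^sub>m 1\<^sub>m n) P Q"
proof -
  note w = similar_mat_witD2[OF A sim]
  have "P * (B + c \<cdot>\<^sub>m 1\<^sub>m n) * Q = (P * B + P * (c \<cdot>\<^sub>m 1\<^sub>m n)) * Q"
    using w by (subst mult_add_distrib_mat[of _ n n]) auto
  also have "\<dots> = P * B * Q + P * (c \<cdot>\<^sub>m 1\<^sub>m n) * Q"
    using w by (subst add_mult_distrib_mat[of _ n n]) auto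
  also have "P * (c \<cdot>\<^sub>m 1\<^sub>m n) * Q = c \<cdot>\<^sub>m 1\<^sub>m n"
    using w(1,6,7) by (simp add: mult_smult_distrib[of _ n n _ n] mult_smult_assoc_mat[of _ n n _ n])
  finally show ?thesis
    using w A by (intro similar_mat_witI[of _ _ n]) auto
qed

text \<open>A nonzero term of entry \<open>(i, j)\<close> needs \<open>i \<le> l\<close> and
  \<open>l \<le> j\<close>: nothing survives below the diagonal, and only \<open>l = i\<close> on
  it.\<close>

lemma upper_triangular_mult:
  fixes A B :: "'a::semiring_0 mat"
  assumes A: "A \<in> carrier_mat n n" "upper_triangular A"
    and B: "B \<in> carrier_mat n n" "upper_triangular B"
  shows "upper_triangular (A * B)"
    and "i < n \<Longrightarrow> (A * B) $$ (i, i) = A $$ (i, i) * B $$ (i, i)"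
proof -
  have zero: "A $$ (i, l) * B $$ (l, j) = 0"
    if "i < n" "l < n" "j \<le> i" "l \<noteq> i \<or> j < i" for i j l
    using that A B by (cases "l < i") (auto simp: upper_triangular_def)
  show "upper_triangular (A * B)"
    unfolding upper_triangular_def using A B zero
    by (auto simp: index_mult_mat_sum[OF A(1) B(1)] simp del: index_mult_mat(1) intro!: sum.neutral)
  show "(A * B) $$ (i, i) = A $$ (i, i) * B $$ (i, i)" if "i < n"
  proof -
    have "(A * B) $$ (i, i) = (\<Sum>l<n. if l = i then A $$ (i, l) * B $$ (l, i) else 0)"
      unfolding index_mult_mat_sum[OF A(1) B(1) that that]
      using zero that by (intro sum.cong) auto
    then show ?thesis using that by simp
  qed
qed

lemma trace_square_symmetric:
  assumes A: "A \<in> carrier_mat n n" and sym: "A\<^sup>T = A"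
  shows "trace (A * A) = (\<Sum>i<n. \<Sum>j<n. (A $$ (i, j))\<^sup>2 :: real)"
proof -
  have "A $$ (j, i) = A $$ (i, j)" if "i < n" "j < n" for i j
    using A that by (subst sym[symmetric]) simp
  then show ?thesis
    unfolding trace_def using A
    by (auto simp: index_mult_mat_sum[OF A A] power2_eq_square simp del: index_mult_mat(1) intro!: sum.cong)
qed

text \<open>The Hermitian form \<open>h\<close> equals \<open>c\<close> times the squared norm
  \<open>r\<close> of \<open>v\<close>. Conjugation merely swaps its summation indices, because
  \<open>A\<close> is real and symmetric, so \<open>h\<close> is real; and \<open>r\<close> is
  nonzero.\<close>

lemma real_symmetric_eigenvalue_real:
  assumes A: "A \<in> carrier_mat n n" and sym: "A\<^sup>T = (A :: real mat)"
    and ev: "eigenvalue (map_mat complex_of_real A) c"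
  shows "c \<in> \<real>"
proof -
  from ev A obtain v where v: "v \<in> carrier_vec n" "v \<noteq> 0\<^sub>v n"
    and eq: "map_mat complex_of_real A *\<^sub>v v = c \<cdot>\<^sub>v v"
    unfolding eigenvalue_def eigenvector_def by auto
  have A_sym: "A $$ (j, i) = A $$ (i, j)" if "i < n" "j < n" for i j
    using A that by (subst sym[symmetric]) simp
  have row: "(\<Sum>j<n. A $$ (i, j) * v $ j) = c * v $ i" if "i < n" for i
  proof -
    have "(map_mat complex_of_real A *\<^sub>v v) $ i = (\<Sum>j<n. A $$ (i, j) * v $ j)"
      using A v that by (auto simp: scalar_prod_def atLeast0LessThan intro!: sum.cong)
    then show ?thesis unfolding eq using v that by simp
  qed
  define h where "h = (\<Sum>i<n. \<Sum>j<n. cnj (v $ i) * (A $$ (i, j) * v $ j))"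
  define r where "r = (\<Sum>i<n. (cmod (v $ i))\<^sup>2)"
  have "h = (\<Sum>i<n. cnj (v $ i) * (c * v $ i))"
    unfolding h_def by (intro sum.cong refl) (simp add: row flip: sum_distrib_left)
  also have "\<dots> = c * of_real r"
    unfolding r_def of_real_sum sum_distrib_left
    by (intro sum.cong refl) (simp add: complex_norm_square mult_ac flip: complex_norm_square)
  finally have h: "h = c * of_real r" .
  have "cnj h = (\<Sum>i<n. \<Sum>j<n. cnj (v $ j) * (A $$ (j, i) * v $ i))"
    unfolding h_def cnj_sum by (intro sum.cong refl) (simp add: A_sym mult_ac)
  also have "\<dots> = h" unfolding h_def by (rule sum.swap)
  finally have "h \<in> \<real>" by (simp add: Reals_cnj_iff)
  have "r \<noteq> 0"
  proof
    assume "r = 0"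
    then have "\<forall>i<n. v $ i = 0" unfolding r_def by (subst (asm) sum_nonneg_eq_0_iff) auto
    then have "v = 0\<^sub>v n" using v by (intro eq_vecI) auto
    with v show False by simp
  qed
  then have "c = h / of_real r" using h by simp
  then show ?thesis using \<open>h \<in> \<real>\<close> by simp
qed

lemma proots_prod_linear_factors:
  "proots (\<Prod>a\<leftarrow>as. [:- a, 1:]) = mset (as :: 'a::idom list)"
proof -
  have "0 \<notin> set (map (\<lambda>a. [:- a, 1:]) as)" by auto
  from proots_prod_list[OF this] have "proots (\<Prod>a\<leftarrow>as. [:- a, 1:]) = (\<Sum>a\<leftarrow>as. {#a#})"
    by (simp add: o_def)
  also have "\<dots> = mset as" by (induction as) auto
  finally show ?thesis .
qed

text \<open>The polynomial factors over the complex numbers with real roots only, and the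
  factorisation is pulled back along the injective embedding of real polynomials.\<close>

lemma char_poly_real_symmetric_splits:
  assumes A: "A \<in> carrier_mat n n" and sym: "A\<^sup>T = (A :: real mat)"
  obtains as where "char_poly A = (\<Prod>a\<leftarrow>as. [:- a, 1:])" "length as = n"
proof -
  let ?C = "map_mat complex_of_real A"
  interpret of_real_poly: map_poly_inj_idom_hom complex_of_real ..
  have C: "?C \<in> carrier_mat n n" using A by simp
  obtain cs where cs: "char_poly ?C = (\<Prod>c\<leftarrow>cs. [:- c, 1:])" "length cs = n"
    using char_poly_factorized[OF C] by auto
  have "c \<in> \<real>" if "c \<in> set cs" for c
  proof -
    have "poly (char_poly ?C) c = 0" unfolding cs(1) using that
      by (auto simp: poly_prod_list prod_list_zero_iff)
    then have "eigenvalue ?C c" using eigenvalue_root_char_poly[OF C] by simp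
    then show ?thesis using real_symmetric_eigenvalue_real[OF A sym] by simp
  qed
  then have cs_Re: "cs = map (complex_of_real \<circ> Re) cs" by (auto intro!: map_idI[symmetric])
  have "map_poly complex_of_real (char_poly A) = char_poly ?C"
    by (rule of_real_hom.char_poly_hom[OF A, symmetric])
  also have "\<dots> = map_poly complex_of_real (\<Prod>a\<leftarrow>map Re cs. [:- a, 1:])"
    unfolding cs(1) by (subst cs_Re) (simp add: of_real_poly.hom_prod_list o_def)
  finally have "char_poly A = (\<Prod>a\<leftarrow>map Re cs. [:- a, 1:])" by simp
  then show ?thesis using that[of "map Re cs"] cs(2) by simp
qed

text \<open>A Schur form is triangular with diagonal \<open>as\<close>, and traces are invariant
  under similarity. The last identity, with two shifts, serves matrices that have only two distinct
  eigenvalues.\<close>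

lemma trace_eigenvalues:
  fixes A :: "'a::conjugatable_ordered_field mat"
  assumes A: "A \<in> carrier_mat n n" and cp: "char_poly A = (\<Prod>a\<leftarrow>as. [:- a, 1:])"
  shows "length as = n"
    and "trace A = (\<Sum>i<n. as ! i)"
    and "trace (A * A) = (\<Sum>i<n. (as ! i)\<^sup>2)"
    and "trace ((A + c \<cdot>\<^sub>m 1\<^sub>m n) * (A + d \<cdot>\<^sub>m 1\<^sub>m n) * ((A + c \<cdot>\<^sub>m 1\<^sub>m n) * (A + d \<cdot>\<^sub>m 1\<^sub>m n)))
           = (\<Sum>i<n. ((as ! i + c) * (as ! i + d))\<^sup>2)"
proof -
  obtain B P Q where "schur_decomposition A as = (B, P, Q)"
    by (cases "schur_decomposition A as")
  from schur_decomposition[OF A cp this]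
  have sim: "similar_mat_wit A B P Q" and ut: "upper_triangular B" and diag: "diag_mat B = as"
    by auto
  note B = similar_mat_witD2(5)[OF A sim]
  show "length as = n" using B diag by (auto simp: diag_mat_def)
  have B_diag: "B $$ (i, i) = as ! i" if "i < n" for i
    using that B by (auto simp: diag_mat_def simp flip: diag)
  show "trace A = (\<Sum>i<n. as ! i)"
    unfolding trace_similar[OF A sim] using B by (simp add: trace_def B_diag)
  have AA: "A * A \<in> carrier_mat n n" using A by simp
  show "trace (A * A) = (\<Sum>i<n. (as ! i)\<^sup>2)"
    unfolding trace_similar[OF AA similar_mat_wit_mult[OF A A sim sim]] using B
    by (simp add: trace_def B_diag upper_triangular_mult(2)[OF B ut B ut] power2_eq_square
        del: index_mult_mat(1))
  let ?A = "\<lambda>c. A + c \<cdot>\<^sub>m 1\<^sub>m n" and ?B = "\<lambda>c. B + c \<cdot>\<^sub>m 1\<^sub>m n"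
  have A': "?A c \<in> carrier_mat n n" and B': "?B c \<in> carrier_mat n n" for c
    using A B by simp_all
  have ut': "upper_triangular (?B c)" for c
    using ut B by (auto simp: upper_triangular_def)
  have sim': "similar_mat_wit (?A c) (?B c) P Q" for c
    by (rule similar_mat_wit_add_scalar[OF A sim])
  note AA = mult_carrier_mat[OF A' A'] and BB = mult_carrier_mat[OF B' B']
  note sim2 = similar_mat_wit_mult[OF A' A' sim' sim']
  note ut2 = upper_triangular_mult(1)[OF B' ut' B' ut']
  show "trace (?A c * ?A d * (?A c * ?A d)) = (\<Sum>i<n. ((as ! i + c) * (as ! i + d))\<^sup>2)"
    unfolding trace_similar[OF mult_carrier_mat[OF AA AA] similar_mat_wit_mult[OF AA AA sim2 sim2]]
    unfolding trace_def using B
    by (auto simp: B_diag upper_triangular_mult(2)[OF BB ut2 BB ut2]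
        upper_triangular_mult(2)[OF B' ut' B' ut'] power2_eq_square
        simp del: index_mult_mat(1) intro!: sum.cong)
qed

text \<open>
  The matrix \<open>M = (A - a) * (A - b)\<close> is symmetric and \<open>M * M\<close> has only zero eigenvalues, so
  \<open>trace (M * M)\<close>, the sum of the squared entries of \<open>M\<close>, vanishes. This avoids an orthogonal
  diagonalisation of \<open>A\<close>.
\<close>

lemma real_symmetric_two_eigenvalues:
  fixes A :: "real mat"
  assumes A: "A \<in> carrier_mat n n" and sym: "A\<^sup>T = A"
    and cp: "char_poly A = (\<Prod>x\<leftarrow>as. [:- x, 1:])" and two: "set as \<subseteq> {a, b}"
    and ij: "i < n" "j < n" "i \<noteq> j"
  shows "(\<Sum>l<n. A $$ (i, l) * A $$ (l, j)) = (a + b) * A $$ (i, j)"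
proof -
  let ?A = "\<lambda>c. A + c \<cdot>\<^sub>m 1\<^sub>m n"
  have A': "?A c \<in> carrier_mat n n" for c using A by simp
  define M where "M = ?A (- a) * ?A (- b)"
  have M: "M \<in> carrier_mat n n" unfolding M_def by (rule mult_carrier_mat[OF A' A'])
  have A_sym: "A $$ (j, i) = A $$ (i, j)" if "i < n" "j < n" for i j
    using A that by (subst sym[symmetric]) simp
  have M_entry: "M $$ (i, j) = (\<Sum>l<n. A $$ (i, l) * A $$ (l, j)) - (a + b) * A $$ (i, j)
      + (if i = j then a * b else 0)" if "i < n" "j < n" for i j
  proof -
    have "M $$ (i, j) = (\<Sum>l<n. (A $$ (i, l) - (if l = i then a else 0)) * (A $$ (l, j) - (if l = j then b else 0)))"
      unfolding M_def index_mult_mat_sum[OF A' A' that] using A that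
      by (intro sum.cong) auto
    also have "\<dots> = (\<Sum>l<n. A $$ (i, l) * A $$ (l, j) - (if l = i then a * A $$ (l, j) else 0)
        - (if l = j then b * A $$ (i, l) else 0) + (if l = i then (if i = j then a * b else 0) else 0))"
      by (intro sum.cong) (auto simp: algebra_simps)
    also have "\<dots> = (\<Sum>l<n. A $$ (i, l) * A $$ (l, j)) - (a + b) * A $$ (i, j)
      + (if i = j then a * b else 0)"
      using that by (simp add: sum.distrib sum_subtractf algebra_simps)
    finally show ?thesis .
  qed
  have M_sym: "M\<^sup>T = M"
  proof (rule eq_matI)
    fix i j assume "i < dim_row M" "j < dim_col M"
    then have ij: "i < n" "j < n" using M by auto
    have "(\<Sum>l<n. A $$ (j, l) * A $$ (l, i)) = (\<Sum>l<n. A $$ (i, l) * A $$ (l, j))"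
      using ij by (intro sum.cong) (auto simp: A_sym mult.commute)
    then show "M\<^sup>T $$ (i, j) = M $$ (i, j)" using ij M by (simp add: M_entry A_sym)
  qed (use M in auto)
  have "length as = n" using trace_eigenvalues(1)[OF A cp] .
  then have "(as ! i + - a) * (as ! i + - b) = 0" if "i < n" for i
    using two that by (auto dest: nth_mem)
  then have "trace (M * M) = 0"
    unfolding M_def trace_eigenvalues(4)[OF A cp] by (intro sum.neutral) auto
  then have "(\<Sum>i<n. \<Sum>j<n. (M $$ (i, j))\<^sup>2) = 0"
    using trace_square_symmetric[OF M M_sym] by simp
  then have "M $$ (i, j) = 0" using ij
    by (subst (asm) sum_nonneg_eq_0_iff) (auto simp: sum_nonneg sum_nonneg_eq_0_iff)
  then show ?thesis using ij by (simp add: M_entry)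
qed

subsection \<open>Simple graphs\<close>

lemma sum_nth_eq_sum_set:
  assumes "distinct xs"
  shows "(\<Sum>i<length xs. f (xs ! i)) = sum f (set xs)"
  by (rule sum.reindex_bij_betw[OF bij_betw_nth[OF assms]]) auto

lemma (in graph) connected_reachable:
  assumes "connected G" "u \<in> verts G" "v \<in> verts G"
  shows "u \<rightarrow>\<^sup>* v"
  using assms symmetric_connected_imp_strongly_connected[OF sym_arcs] by auto

text \<open>Without parallel arcs, \<open>head G\<close> is injective on the arcs leaving
  \<open>v\<close>.\<close>

lemma (in nomulti_digraph) out_degree_eq_card_neighbours:
  "out_degree G v = card {w \<in> verts G. v \<rightarrow>\<^bsub>G\<^esub> w}"
  unfolding out_degree_def
  by (rule bij_betw_same_card[of "head G"], rule bij_betwI')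
    (auto simp: arcs_ends_conv arc_to_ends_def intro: no_multi_arcs)

text \<open>Each fibre of \<open>?f\<close> is an arc with its reverse: they differ since there are
  no loops, and no further arc occurs since there are no parallel ones.\<close>

lemma (in graph) card_arcs_eq_twice_num_edges: "card (arcs G) = 2 * num_edges G"
proof -
  let ?f = "\<lambda>e. {tail G e, head G e}"
  have "card {e \<in> arcs G. ?f e = ?f a} = 2" if a: "a \<in> arcs G" for a
  proof -
    obtain b where b: "b \<in> arcs G" "tail G a = head G b" "head G a = tail G b"
      using sym_arcs a unfolding symmetric_conv by blast
    have "{e \<in> arcs G. ?f e = ?f a} = {a, b}"
      using a b no_multi_arcs by (auto simp: doubleton_eq_iff arc_to_ends_def)
    moreover have "a \<noteq> b" using no_loops[OF a] b by auto
    ultimately show ?thesis by simp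
  qed
  then have "(\<Sum>y\<in>?f ` arcs G. card {e \<in> arcs G. ?f e = y}) = (\<Sum>y\<in>?f ` arcs G. 2)"
    by (intro sum.cong) auto
  moreover have "card (arcs G) = (\<Sum>y\<in>?f ` arcs G. card {e \<in> arcs G. ?f e = y})"
    using sum.image_gen[OF finite_arcs, of "\<lambda>_. 1::nat" ?f] by simp
  ultimately show ?thesis by (simp add: num_edges_def)
qed

lemma (in fin_digraph) sum_out_degree: "(\<Sum>v\<in>verts G. out_degree G v) = card (arcs G)"
proof -
  have "card (arcs G) = (\<Sum>v\<in>verts G. card {e \<in> arcs G. tail G e = v})"
    using sum.group[of "arcs G" "verts G" "tail G" "\<lambda>_. 1::nat"] by (simp add: image_subsetI)
  then show ?thesis by (simp add: out_degree_def out_arcs_def)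
qed

lemma (in graph) sum_degree_real:
  "(\<Sum>v\<in>verts G. real (out_degree G v)) = 2 * real (num_edges G)"
  using sum_out_degree card_arcs_eq_twice_num_edges by (simp flip: of_nat_sum)

text \<open>A path to some second vertex has to begin with an arc leaving \<open>v\<close>.\<close>

lemma (in graph) out_degree_pos:
  assumes "connected G" "card (verts G) \<ge> 2" "v \<in> verts G"
  shows "out_degree G v > 0"
proof -
  have "verts G \<noteq> {v}" using assms(2) by auto
  then obtain w where w: "w \<in> verts G" "w \<noteq> v" using assms(3) by auto
  from connected_reachable[OF assms(1,3) w(1)] obtain u where "v \<rightarrow>\<^bsub>G\<^esub> u"
    using w(2) by (cases rule: converse_reachable_cases) auto
  then have "u \<in> {w \<in> verts G. v \<rightarrow>\<^bsub>G\<^esub> w}" by (auto dest: adj_in_verts)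
  then show ?thesis
    unfolding out_degree_eq_card_neighbours by (auto simp: card_gt_0_iff)
qed

text \<open>Along a path from \<open>u\<close>, being equal or adjacent to \<open>u\<close> passes
  from each vertex to the next; connectedness supplies a path to every vertex.\<close>

lemma (in graph) complete_digraph_if_adjacency_transitive:
  assumes con: "connected G"
    and tr: "\<And>u v w. u \<rightarrow>\<^bsub>G\<^esub> v \<Longrightarrow> v \<rightarrow>\<^bsub>G\<^esub> w \<Longrightarrow> u \<noteq> w \<Longrightarrow> u \<rightarrow>\<^bsub>G\<^esub> w"
  shows "complete_digraph (card (verts G)) G"
proof -
  have adj: "u \<rightarrow>\<^bsub>G\<^esub> v" if "u \<in> verts G" "v \<in> verts G" "u \<noteq> v" for u v
  proof -
    have "u = v \<or> u \<rightarrow>\<^bsub>G\<^esub> v" using connected_reachable[OF con that(1,2)]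
      by (induction rule: reachable_induct) (auto dest: tr)
    then show ?thesis using that by simp
  qed
  have "arcs_ends G = {(u, v). (u, v) \<in> verts G \<times> verts G \<and> u \<noteq> v}"
    using adj by (auto dest: adj_in_verts adj_not_same)
  then show ?thesis unfolding complete_digraph_def using graph_axioms by simp
qed

lemma complete_digraph_out_degree:
  assumes "complete_digraph n G" "v \<in> verts G"
  shows "out_degree G v = n - 1"
proof -
  interpret graph G using assms by (simp add: complete_digraph_def)
  have "{w \<in> verts G. v \<rightarrow>\<^bsub>G\<^esub> w} = verts G - {v}"
    using assms by (auto simp: complete_digraph_def)
  then show ?thesis using assms
    by (simp add: out_degree_eq_card_neighbours complete_digraph_def)
qed

subsection \<open>Sums of squares\<close>

text \<open>The variance identity. It exhibits the defect of Cauchy--Schwarz against a constant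
  function as a sum of squares.\<close>

lemma sum_square_deviation:
  fixes f :: "'b \<Rightarrow> real"
  assumes "finite A" "A \<noteq> {}"
  shows "(\<Sum>i\<in>A. (f i - sum f A / card A)\<^sup>2) = (\<Sum>i\<in>A. (f i)\<^sup>2) - (sum f A)\<^sup>2 / card A"
proof -
  define c where "c = sum f A / card A"
  have c: "card A * c = sum f A" using assms by (simp add: c_def card_gt_0_iff)
  have "(\<Sum>i\<in>A. (f i - c)\<^sup>2) = (\<Sum>i\<in>A. (f i)\<^sup>2) - 2 * c * sum f A + card A * c * c"
    by (simp add: power2_eq_square algebra_simps sum.distrib sum_subtractf flip: sum_distrib_left sum_distrib_right)
  also have "\<dots> = (\<Sum>i\<in>A. (f i)\<^sup>2) - c * sum f A" unfolding c by simp
  also have "c * sum f A = (sum f A)\<^sup>2 / card A" by (simp add: c_def power2_eq_square)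
  finally show ?thesis unfolding c_def .
qed

text \<open>Cauchy--Schwarz on the blocks \<open>{..<k}\<close> and \<open>{k..<n}\<close>, kept as
  an exact identity: the spread of each block around its mean is the defect. The inequality and its
  equality case can then both be read off.\<close>

lemma partial_sum_deviation:
  fixes q :: "nat \<Rightarrow> real"
  assumes k: "0 < k" "k < n"
  defines "S \<equiv> \<Sum>i<k. q i" and "T \<equiv> \<Sum>i<n. q i"
  shows "(n * S - k * T)\<^sup>2
         + n * k * (real n - real k) * ((\<Sum>i<k. (q i - S / k)\<^sup>2) + (\<Sum>i=k..<n. (q i - (T - S) / (real n - real k))\<^sup>2))
         = k * (real n - real k) * (n * (\<Sum>i<n. (q i)\<^sup>2) - T\<^sup>2)"
proof -
  have split: "(\<Sum>i<n. f i) = (\<Sum>i<k. f i) + (\<Sum>i=k..<n. f i)" for f :: "nat \<Rightarrow> real"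
    using k by (simp add: sum.atLeastLessThan_concat atLeast0LessThan[symmetric])
  have tail: "(\<Sum>i=k..<n. q i) = T - S" unfolding T_def S_def split[of q] by simp
  have "(\<Sum>i<k. (q i - S / k)\<^sup>2) = (\<Sum>i<k. (q i)\<^sup>2) - S\<^sup>2 / k"
    using sum_square_deviation[of "{..<k}" q] k by (simp add: S_def lessThan_empty_iff)
  moreover have "(\<Sum>i=k..<n. (q i - (T - S) / (real n - real k))\<^sup>2) = (\<Sum>i=k..<n. (q i)\<^sup>2) - (T - S)\<^sup>2 / (real n - real k)"
    using sum_square_deviation[of "{k..<n}" q] k by (simp add: tail of_nat_diff)
  ultimately have *: "(\<Sum>i<k. (q i - S / k)\<^sup>2) + (\<Sum>i=k..<n. (q i - (T - S) / (real n - real k))\<^sup>2)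
      = (\<Sum>i<n. (q i)\<^sup>2) - S\<^sup>2 / k - (T - S)\<^sup>2 / (real n - real k)"
    by (simp add: split)
  show ?thesis
    unfolding * using k by (simp add: of_nat_diff field_simps power2_eq_square)
qed

lemma partial_sum_bound:
  fixes q :: "nat \<Rightarrow> real"
  assumes k: "0 < k" "k < n"
  shows "(n * (\<Sum>i<k. q i) - k * (\<Sum>i<n. q i))\<^sup>2
         \<le> k * (real n - real k) * (n * (\<Sum>i<n. (q i)\<^sup>2) - (\<Sum>i<n. q i)\<^sup>2)"
  using k by (subst partial_sum_deviation[OF k, symmetric]) (auto intro!: mult_nonneg_nonneg add_nonneg_nonneg sum_nonneg)

text \<open>Equality makes the defect vanish, so every entry equals the mean of its block.\<close>

lemma partial_sum_bound_eqD:
  fixes q :: "nat \<Rightarrow> real"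
  assumes k: "0 < k" "k < n"
    and eq: "(n * (\<Sum>i<k. q i) - k * (\<Sum>i<n. q i))\<^sup>2
         = k * (real n - real k) * (n * (\<Sum>i<n. (q i)\<^sup>2) - (\<Sum>i<n. q i)\<^sup>2)"
  obtains a b where "\<And>i. i < k \<Longrightarrow> q i = a" "\<And>i. k \<le> i \<Longrightarrow> i < n \<Longrightarrow> q i = b"
proof -
  define S T where "S = (\<Sum>i<k. q i)" and "T = (\<Sum>i<n. q i)"
  let ?D1 = "\<Sum>i<k. (q i - S / k)\<^sup>2" and ?D2 = "\<Sum>i=k..<n. (q i - (T - S) / (real n - real k))\<^sup>2"
  have "real n * real k * (real n - real k) * (?D1 + ?D2) = 0"
    using partial_sum_deviation[OF k, of q] eq unfolding S_def T_def by linarith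
  then have "?D1 + ?D2 = 0" using k by auto
  moreover have "?D1 \<ge> 0" "?D2 \<ge> 0" by (simp_all add: sum_nonneg)
  ultimately have "?D1 = 0" "?D2 = 0" by linarith+
  then show ?thesis
    by (intro that[of "S / k" "(T - S) / (real n - real k)"]) (auto simp: sum_nonneg_eq_0_iff)
qed

text \<open>Sum \<open>(x i - \<delta>) * (\<Delta> - x i) \<ge> 0\<close> over \<open>A\<close> and apply AM-GM.\<close>

lemma polya_szego_sum_squares:
  fixes x :: "'b \<Rightarrow> real"
  assumes fin: "finite A" and \<delta>: "0 < \<delta>" and \<Delta>: "0 < \<Delta>"
    and bounds: "\<And>i. i \<in> A \<Longrightarrow> \<delta> \<le> x i \<and> x i \<le> \<Delta>"
  shows "4 * (\<Delta> * \<delta>) * (card A * (\<Sum>i\<in>A. (x i)\<^sup>2)) \<le> (\<Delta> + \<delta>)\<^sup>2 * (sum x A)\<^sup>2"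
proof -
  let ?N = "real (card A)" and ?S = "sum x A" and ?S2 = "\<Sum>i\<in>A. (x i)\<^sup>2"
  have "0 \<le> (\<Sum>i\<in>A. (x i - \<delta>) * (\<Delta> - x i))"
    using bounds by (intro sum_nonneg) auto
  also have "\<dots> = (\<Delta> + \<delta>) * ?S - ?S2 - ?N * (\<Delta> * \<delta>)"
    by (simp add: algebra_simps sum.distrib sum_subtractf sum_distrib_left power2_eq_square)
  finally have "?S2 \<le> (\<Delta> + \<delta>) * ?S - ?N * (\<Delta> * \<delta>)" by simp
  then have "4 * (\<Delta> * \<delta>) * ?N * ?S2 \<le> 4 * (\<Delta> * \<delta>) * ?N * ((\<Delta> + \<delta>) * ?S - ?N * (\<Delta> * \<delta>))"
    using \<delta> \<Delta> by (intro mult_left_mono) auto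
  \<comment> \<open>This is 4 Y (X - Y) = X^2 - (X - 2 Y)^2 for
    \<open>X = (\<Delta> + \<delta>) * ?S\<close> and
    \<open>Y = ?N * (\<Delta> * \<delta>)\<close>.\<close>
  also have "\<dots> = (\<Delta> + \<delta>)\<^sup>2 * ?S\<^sup>2 - ((\<Delta> + \<delta>) * ?S - 2 * ?N * (\<Delta> * \<delta>))\<^sup>2"
    by (simp add: power2_eq_square algebra_simps)
  also have "\<dots> \<le> (\<Delta> + \<delta>)\<^sup>2 * ?S\<^sup>2" by simp
  finally show ?thesis by (simp add: mult_ac)
qed

subsection \<open>The spectrum of the signless Laplacian\<close>

locale ordered_graph = graph G for G :: "('a, 'b) pre_digraph" (structure) +
  fixes vs :: "'a list" and n :: nat
  assumes distinct_vs: "distinct vs" and set_vs: "set vs = verts G"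
    and n_def: "n = card (verts G)"
begin

abbreviation "Q \<equiv> signless_laplacian G vs"
abbreviation "d \<equiv> \<lambda>v. real (out_degree G v)"

lemma length_vs: "length vs = n"
  using distinct_vs set_vs n_def distinct_card by metis

lemma nth_vs_in_verts: "i < n \<Longrightarrow> vs ! i \<in> verts G"
  using set_vs length_vs nth_mem by metis

lemma sum_vs: "(\<Sum>i<n. f (vs ! i)) = sum f (verts G)"
  using sum_nth_eq_sum_set[OF distinct_vs] length_vs set_vs by simp

lemma Q_carrier: "Q \<in> carrier_mat n n"
  by (simp add: signless_laplacian_def degree_matrix_def adjacency_matrix_def length_vs)

lemma Q_index:
  assumes "i < n" "j < n"
  shows "Q $$ (i, j) = (if i = j then d (vs ! i) else if vs ! i \<rightarrow>\<^bsub>G\<^esub> vs ! j then 1 else 0)"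
  using assms by (auto simp: signless_laplacian_def degree_matrix_def adjacency_matrix_def
      length_vs mat_diag_def dest: adj_not_same)

lemma Q_sym: "Q\<^sup>T = Q"
  using Q_carrier arcs_ends_symmetric[OF sym_arcs]
  by (intro eq_matI) (auto simp: Q_index)

lemma sum_adjacent:
  "(\<Sum>j<n. if vs ! i \<rightarrow>\<^bsub>G\<^esub> vs ! j then 1 else 0) = d (vs ! i)"
proof -
  have "(\<Sum>j<n. if vs ! i \<rightarrow>\<^bsub>G\<^esub> vs ! j then 1 else 0) = (\<Sum>w\<in>verts G. if vs ! i \<rightarrow>\<^bsub>G\<^esub> w then 1 else 0 :: real)"
    by (rule sum_vs)
  also have "\<dots> = d (vs ! i)"
    by (subst sum.inter_filter[symmetric]) (auto simp: out_degree_eq_card_neighbours)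
  finally show ?thesis .
qed

text \<open>Off-diagonal entries are 0 or 1 and hence fixed by \<open>f\<close>, so together they
  contribute the degree. The square as \<open>f\<close> gives the trace of \<open>Q * Q\<close>; the
  identity gives the action on the all-ones vector.\<close>

lemma row_sum_Q:
  assumes "i < n" and "f 0 = 0" "f 1 = (1 :: real)"
  shows "(\<Sum>j<n. f (Q $$ (i, j))) = f (d (vs ! i)) + d (vs ! i)"
proof -
  have "(\<Sum>j<n. f (Q $$ (i, j))) = (\<Sum>j<n. (if i = j then f (d (vs ! i)) else 0)
      + (if vs ! i \<rightarrow>\<^bsub>G\<^esub> vs ! j then 1 else 0))"
    using assms by (intro sum.cong) (auto simp: Q_index dest: adj_not_same)
  then show ?thesis using assms(1) by (simp add: sum.distrib sum_adjacent)
qed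

lemma trace_Q: "trace Q = 2 * real (num_edges G)"
proof -
  have "trace Q = (\<Sum>i<n. d (vs ! i))"
    unfolding trace_def using Q_carrier by (auto simp: Q_index)
  then show ?thesis by (simp only: sum_vs[of d] sum_degree_real)
qed

lemma trace_Q_square:
  "trace (Q * Q) = (\<Sum>v\<in>verts G. (d v)\<^sup>2) + 2 * real (num_edges G)"
proof -
  have "trace (Q * Q) = (\<Sum>i<n. (d (vs ! i))\<^sup>2 + d (vs ! i))"
    unfolding trace_square_symmetric[OF Q_carrier Q_sym] by (intro sum.cong refl row_sum_Q) auto
  also have "\<dots> = (\<Sum>v\<in>verts G. (d v)\<^sup>2 + d v)" by (rule sum_vs)
  finally show ?thesis by (simp add: sum.distrib sum_degree_real)
qed

section \<open>The eigenvalue list and its power sums\<close>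

abbreviation "qs \<equiv> signless_eigenvalues G vs"

text \<open>\<open>proots\<close> sees real roots only; splitting over the reals guarantees that
  none is lost. Sorting only permutes the linear factors.\<close>

lemma char_poly_Q: "char_poly Q = (\<Prod>q\<leftarrow>qs. [:- q, 1:])"
proof -
  obtain as where as: "char_poly Q = (\<Prod>a\<leftarrow>as. [:- a, 1:])"
    using char_poly_real_symmetric_splits[OF Q_carrier Q_sym] by metis
  have "mset qs = mset as"
    by (simp add: signless_eigenvalues_def as proots_prod_linear_factors)
  then have "mset (map (\<lambda>a. [:- a, 1:]) qs) = mset (map (\<lambda>a. [:- a, 1:]) as)" by simp
  then show ?thesis unfolding as by (metis prod_mset_prod_list)
qed

lemma length_qs: "length qs = n"
  by (rule trace_eigenvalues(1)[OF Q_carrier char_poly_Q])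

lemma signless_sum_eq: "k \<le> n \<Longrightarrow> signless_sum G vs k = (\<Sum>i<k. qs ! i)"
  by (simp add: signless_sum_def sum_list_sum_nth length_qs atLeast0LessThan min_absorb2)

lemma sum_qs: "(\<Sum>i<n. qs ! i) = 2 * real (num_edges G)"
  using trace_eigenvalues(2)[OF Q_carrier char_poly_Q] trace_Q by simp

lemma sum_qs_square:
  "(\<Sum>i<n. (qs ! i)\<^sup>2) = (\<Sum>v\<in>verts G. (d v)\<^sup>2) + 2 * real (num_edges G)"
  using trace_eigenvalues(3)[OF Q_carrier char_poly_Q] trace_Q_square by simp

lemma eigenvalue_le_first:
  assumes "eigenvalue Q c"
  shows "c \<le> qs ! 0"
proof -
  have "poly (char_poly Q) c = 0" using assms eigenvalue_root_char_poly[OF Q_carrier] by simp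
  then have "c \<in> set qs" by (auto simp: char_poly_Q poly_prod_list prod_list_zero_iff)
  moreover have "sorted (rev qs)" by (simp add: signless_eigenvalues_def)
  ultimately show ?thesis by (auto simp: in_set_conv_nth sorted_rev_iff_nth_mono)
qed

text \<open>Every row sums to \<open>r + r\<close>, so the all-ones vector is an
  eigenvector.\<close>

lemma regular_eigenvalue:
  assumes "n > 0" "\<And>v. v \<in> verts G \<Longrightarrow> out_degree G v = r"
  shows "eigenvalue Q (2 * real r)"
proof -
  define v :: "real vec" where "v = Matrix.vec n (\<lambda>_. 1)"
  have "Q *\<^sub>v v = 2 * real r \<cdot>\<^sub>v v"
  proof (rule eq_vecI)
    fix i assume "i < dim_vec (2 * real r \<cdot>\<^sub>v v)"
    then have i: "i < n" by (simp add: v_def)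
    have "(Q *\<^sub>v v) $ i = (\<Sum>j<n. Q $$ (i, j))"
      using i Q_carrier by (auto simp: v_def scalar_prod_def atLeast0LessThan intro!: sum.cong)
    also have "\<dots> = 2 * real r"
      using row_sum_Q[OF i, of "\<lambda>x. x"] assms(2) nth_vs_in_verts[OF i] by simp
    finally show "(Q *\<^sub>v v) $ i = (2 * real r \<cdot>\<^sub>v v) $ i" using i by (simp add: v_def)
  qed (use Q_carrier in \<open>simp add: v_def\<close>)
  moreover have "v \<noteq> 0\<^sub>v n"
  proof
    assume "v = 0\<^sub>v n"
    then have "v $ 0 = 0" using assms(1) by simp
    then show False using assms(1) by (simp add: v_def)
  qed
  moreover have "v \<in> carrier_vec n" by (simp add: v_def)
  ultimately show ?thesis
    using Q_carrier unfolding eigenvalue_def eigenvector_def by auto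
qed

text \<open>If \<open>u\<close> and \<open>w\<close> were non-adjacent, their entry in
  \<open>Q * Q\<close> would be \<open>a + b\<close> times 0. But all terms of that entry are
  nonnegative, and the one for the common neighbour \<open>v\<close> is positive.\<close>

lemma complete_if_two_eigenvalues:
  assumes con: "connected G" and two: "set qs \<subseteq> {a, b}"
  shows "complete_digraph n G"
  unfolding n_def
proof (rule complete_digraph_if_adjacency_transitive[OF con])
  fix u v w assume uv: "u \<rightarrow>\<^bsub>G\<^esub> v" and vw: "v \<rightarrow>\<^bsub>G\<^esub> w" and "u \<noteq> w"
  have "\<exists>i<n. vs ! i = x" if "x \<in> verts G" for x
    using that set_vs length_vs by (metis in_set_conv_nth)
  then obtain i l j where ilj: "i < n" "vs ! i = u" "l < n" "vs ! l = v" "j < n" "vs ! j = w"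
    using adj_in_verts uv vw by metis
  then have "i \<noteq> j" "i \<noteq> l" "l \<noteq> j" using \<open>u \<noteq> w\<close> uv vw by (auto dest: adj_not_same)
  have nonneg: "Q $$ (i, l) * Q $$ (l, j) \<ge> 0" if "l < n" for l
    using that ilj by (auto simp: Q_index)
  have "0 < Q $$ (i, l) * Q $$ (l, j)"
    using ilj uv vw \<open>i \<noteq> l\<close> \<open>l \<noteq> j\<close> by (simp add: Q_index)
  also have "\<dots> \<le> (\<Sum>l<n. Q $$ (i, l) * Q $$ (l, j))"
    using ilj nonneg by (intro member_le_sum) auto
  also have "\<dots> = (a + b) * Q $$ (i, j)"
    by (rule real_symmetric_two_eigenvalues[OF Q_carrier Q_sym char_poly_Q two]) fact+
  finally show "u \<rightarrow>\<^bsub>G\<^esub> w" using ilj \<open>i \<noteq> j\<close> by (auto simp: Q_index split: if_splits)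
qed

section \<open>The upper bound\<close>

abbreviation "m \<equiv> real (num_edges G)"
abbreviation "D_max \<equiv> real (max_degree G)"
abbreviation "D_min \<equiv> real (min_degree G)"

text \<open>The bound of the theorem is \<open>2 m k / n + sqrt (k (n - k) radicand) / n\<close>.\<close>

definition radicand :: real where
  "radicand = m * (2 * D_max * D_min * (n - 2 * m) + m * (D_max + D_min)\<^sup>2) / (D_max * D_min)"

lemma min_max_degree:
  assumes "v \<in> verts G"
  shows "D_min \<le> d v \<and> d v \<le> D_max"
  using assms by (simp add: min_degree_def max_degree_def)

lemma min_degree_pos:
  assumes "connected G" "n \<ge> 2"
  shows "D_min > 0" "D_max > 0"
proof -
  have ne: "verts G \<noteq> {}" using assms n_def by auto
  then have "min_degree G \<in> out_degree G ` verts G"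
    unfolding min_degree_def by (intro Min_in) auto
  then show "D_min > 0" using out_degree_pos[OF assms(1)] assms(2) n_def by auto
  then show "D_max > 0" using ne min_max_degree by (meson all_not_in_conv less_le_trans)
qed

text \<open>By the trace formulas only the sum of squared degrees is not yet expressed in
  \<open>n\<close> and \<open>m\<close>; Polya--Szego with degree sum \<open>2 * m\<close> estimates
  it.\<close>

lemma eigenvalue_variance_le_radicand:
  assumes "connected G" "n \<ge> 2"
  shows "n * (\<Sum>i<n. (qs ! i)\<^sup>2) - (\<Sum>i<n. qs ! i)\<^sup>2 \<le> radicand"
proof -
  note pos = min_degree_pos[OF assms]
  have "4 * (D_max * D_min) * (n * (\<Sum>v\<in>verts G. (d v)\<^sup>2)) \<le> (D_max + D_min)\<^sup>2 * (2 * m)\<^sup>2"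
    using polya_szego_sum_squares[OF finite_verts pos, of d] min_max_degree
    by (simp add: n_def sum_degree_real)
  then have "n * (\<Sum>v\<in>verts G. (d v)\<^sup>2) \<le> (D_max + D_min)\<^sup>2 * m\<^sup>2 / (D_max * D_min)"
    using pos by (simp add: field_simps)
  moreover have "radicand = 2 * m * n - 4 * m\<^sup>2 + (D_max + D_min)\<^sup>2 * m\<^sup>2 / (D_max * D_min)"
    using pos by (simp add: radicand_def field_simps power2_eq_square)
  ultimately show ?thesis
    unfolding sum_qs sum_qs_square by (simp add: algebra_simps power2_eq_square)
qed

text \<open>Block Cauchy--Schwarz (\<open>cs\<close>) is chained with the degree estimate
  (\<open>R\<close>). Equality in the result makes both sharp, and sharpness of \<open>cs\<close>
  gives the two constant blocks.\<close>

lemma signless_sum_le: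
  assumes "connected G" "n \<ge> 2" "0 < k" "k < n"
  shows "signless_sum G vs k \<le> 2 * m * k / n + sqrt (k * (real n - real k) * radicand) / n"
    and "signless_sum G vs k = 2 * m * k / n + sqrt (k * (real n - real k) * radicand) / n \<Longrightarrow>
           \<exists>a b. (\<forall>i<k. qs ! i = a) \<and> (\<forall>i. k \<le> i \<longrightarrow> i < n \<longrightarrow> qs ! i = b)"
proof -
  let ?S = "signless_sum G vs k"
  let ?V = "n * (\<Sum>i<n. (qs ! i)\<^sup>2) - (\<Sum>i<n. qs ! i)\<^sup>2"
  have S: "?S = (\<Sum>i<k. qs ! i)" using assms by (intro signless_sum_eq) simp
  have cs: "(n * ?S - k * (2 * m))\<^sup>2 \<le> k * (real n - real k) * ?V"
    using partial_sum_bound[OF assms(3,4), of "\<lambda>i. qs ! i"] by (simp add: S sum_qs)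
  have R: "k * (real n - real k) * ?V \<le> k * (real n - real k) * radicand"
    using eigenvalue_variance_le_radicand[OF assms(1,2)] assms(4) by (intro mult_left_mono) auto
  have "n * ?S - k * (2 * m) \<le> sqrt (k * (real n - real k) * radicand)"
    by (rule real_le_rsqrt) (use cs R in linarith)
  then show "?S \<le> 2 * m * k / n + sqrt (k * (real n - real k) * radicand) / n"
    using assms(2) by (simp add: field_simps)
  assume "?S = 2 * m * k / n + sqrt (k * (real n - real k) * radicand) / n"
  then have "n * ?S - k * (2 * m) = sqrt (k * (real n - real k) * radicand)"
    using assms(2) by (simp add: field_simps)
  \<comment> \<open>Needed to square the root away: \<open>sqrt\<close> of a negative real is
    negative. Here \<open>cs\<close> and \<open>R\<close> bound the argument below by a
    square.\<close>
  moreover have "k * (real n - real k) * radicand \<ge> 0"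
    using cs R by (meson order_trans zero_le_power2)
  ultimately have "(n * ?S - k * (2 * m))\<^sup>2 = k * (real n - real k) * radicand" by simp
  then have "(n * ?S - k * (2 * m))\<^sup>2 = k * (real n - real k) * ?V" using cs R by linarith
  then obtain a b where "\<And>i. i < k \<Longrightarrow> qs ! i = a" "\<And>i. k \<le> i \<Longrightarrow> i < n \<Longrightarrow> qs ! i = b"
    using partial_sum_bound_eqD[OF assms(3,4), of "\<lambda>i. qs ! i"] by (metis S sum_qs)
  then show "\<exists>a b. (\<forall>i<k. qs ! i = a) \<and> (\<forall>i. k \<le> i \<longrightarrow> i < n \<longrightarrow> qs ! i = b)" by blast
qed

section \<open>Complete graphs and the equality case\<close>

lemma complete_graph_spectrum:
  assumes K: "complete_digraph n G" and n: "n \<ge> 2"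
  shows "2 * m = n * (real n - 1)" and "radicand = (real n)\<^sup>2 * (real n - 1)"
    and "2 * (real n - 1) \<le> qs ! 0"
proof -
  note deg = complete_digraph_out_degree[OF K]
  have ne: "verts G \<noteq> {}" using n n_def by auto
  then have img: "out_degree G ` verts G = {n - 1}" using deg by auto
  have D: "D_max = real n - 1" "D_min = real n - 1"
    using n by (simp_all add: max_degree_def min_degree_def img of_nat_diff)
  show m: "2 * m = n * (real n - 1)"
    using sum_degree_real deg n by (simp add: n_def of_nat_diff)
  \<comment> \<open>Both extreme degrees are n - 1, so their squared sum is 4 (n - 1)^2 and the
    denominator can be cancelled.\<close>
  have "radicand = (real n - 1)\<^sup>2 * (m * (2 * (n - 2 * m) + 4 * m)) / (real n - 1)\<^sup>2"
    unfolding radicand_def D by (simp add: power2_eq_square algebra_simps)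
  also have "\<dots> = m * (2 * (n - 2 * m) + 4 * m)" using n by simp
  also have "\<dots> = n * (2 * m)" by (simp add: algebra_simps)
  finally show "radicand = (real n)\<^sup>2 * (real n - 1)" by (simp add: m power2_eq_square)
  have "eigenvalue Q (2 * real (n - 1))"
    using n deg by (intro regular_eigenvalue) auto
  then show "2 * (real n - 1) \<le> qs ! 0"
    using eigenvalue_le_first n by (simp add: of_nat_diff)
qed

lemma complete_graph_bound:
  assumes K: "complete_digraph n G" and n: "n \<ge> 2"
  shows "2 * m * k / n + sqrt (k * (real n - real k) * radicand) / n
         = k * (real n - 1) + sqrt (k * (real n - real k) * (real n - 1))"
proof -
  have "k * (real n - real k) * radicand = (real n)\<^sup>2 * (k * (real n - real k) * (real n - 1))"
    by (simp add: complete_graph_spectrum(2)[OF K n])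
  then have "sqrt (k * (real n - real k) * radicand) = n * sqrt (k * (real n - real k) * (real n - 1))"
    by (simp only: real_sqrt_mult) simp
  then show ?thesis using n by (simp add: complete_graph_spectrum(1)[OF K n])
qed

text \<open>The general bound at \<open>k = 1\<close> evaluates to (n - 1) + (n - 1), which meets
  the lower bound from the all-ones vector. The remaining spectrum is never computed.\<close>

lemma complete_graph_first_eigenvalue:
  assumes con: "connected G" and K: "complete_digraph n G" and n: "n \<ge> 2"
  shows "qs ! 0 = 2 * (real n - 1)"
proof -
  have "signless_sum G vs 1 \<le> 2 * (real n - 1)"
    using signless_sum_le(1)[OF con n, of 1] n
    unfolding complete_graph_bound[OF K n] by (simp add: of_nat_diff)
  then show ?thesis
    using complete_graph_spectrum(3)[OF K n] signless_sum_eq[of 1] n by simp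
qed

text \<open>Under equality the graph is complete and the first block consists of \<open>k\<close>
  copies of 2 (n - 1). Comparing their sum with the bound settles \<open>k\<close> without knowing
  multiplicities.\<close>

lemma signless_sum_eq_bound_iff:
  assumes con: "connected G" and n: "n \<ge> 2" and k: "0 < k" "k < n"
  shows "signless_sum G vs k = 2 * m * k / n + sqrt (k * (real n - real k) * radicand) / n
         \<longleftrightarrow> complete_digraph n G \<and> k = 1" (is "?S = ?b \<longleftrightarrow> _")
proof
  assume eq: "?S = ?b"
  then obtain a b where ab: "\<And>i. i < k \<Longrightarrow> qs ! i = a" "\<And>i. k \<le> i \<Longrightarrow> i < n \<Longrightarrow> qs ! i = b"
    using signless_sum_le(2)[OF con n k] by blast
  then have "set qs \<subseteq> {a, b}"
    by (auto simp: in_set_conv_nth length_qs) (metis not_le)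
  then have K: "complete_digraph n G" by (rule complete_if_two_eigenvalues[OF con])
  have "a = 2 * (real n - 1)"
    using ab(1)[of 0] k complete_graph_first_eigenvalue[OF con K n] by simp
  then have "?S = 2 * k * (real n - 1)"
    using k ab(1) by (simp add: signless_sum_eq)
  then have "k * (real n - 1) = sqrt (k * (real n - real k) * (real n - 1))"
    using eq unfolding complete_graph_bound[OF K n] by simp
  then have "(k * (real n - 1))\<^sup>2 = k * (real n - real k) * (real n - 1)"
    using k by (simp add: of_nat_diff)
  \<comment> \<open>Arranged so that the nonzero factor k (n - 1) cancels, leaving k (n - 1) = n -
    k, that is n k = n.\<close>
  then have "(k * (real n - 1)) * (k * (real n - 1)) = (k * (real n - 1)) * (real n - real k)"
    using k by (simp add: power2_eq_square of_nat_diff mult_ac)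
  then have "k * (real n - 1) = real n - real k" using k by simp
  then have "real n * k = real n * 1" by (simp add: algebra_simps)
  then have "k = 1" using k by simp
  with K show "complete_digraph n G \<and> k = 1" by simp
next
  assume "complete_digraph n G \<and> k = 1"
  then show "?S = ?b"
    using complete_graph_bound[of k] complete_graph_first_eigenvalue[OF con] n
    by (simp add: signless_sum_eq of_nat_diff)
qed

end

theorem theorem4:
  fixes G :: "('a, 'b) pre_digraph" and vs :: "'a list"
    and n m k :: nat and \<Delta> \<delta> bound :: real
  assumes "Digraph.graph G" and "Digraph_Component.connected G"
    and "n = card (verts G)" and "n \<ge> 2" and "m = num_edges G"
    and "\<Delta> = real (max_degree G)" and "\<delta> = real (min_degree G)"
    and "distinct vs" and "set vs = verts G"
    and "bound = 2 * real m * real k / real n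
           + sqrt (real m * real k * (real n - real k)
                     * (2 * \<Delta> * \<delta> * (real n - 2 * real m) + real m * (\<Delta> + \<delta>)\<^sup>2))
             / (real n * sqrt (\<Delta> * \<delta>))"
  shows "(1 \<le> k \<and> k \<le> n - 1 \<longrightarrow>
            signless_sum G vs k \<le> bound \<and>
            (signless_sum G vs k = bound \<longleftrightarrow> complete_digraph n G \<and> k = 1)) \<and>
         (k = n \<longrightarrow> signless_sum G vs k = bound \<and> bound = 2 * real m)"
proof -
  interpret ordered_graph G vs n
    using assms by (intro ordered_graph.intro ordered_graph_axioms.intro)
  note con = assms(2) and n = assms(4)
  \<comment> \<open>The denominator \<open>sqrt (\<Delta> * \<delta>)\<close> moves under the root,
    into \<open>radicand\<close>.\<close>
  have bound: "bound = 2 * m * k / n + sqrt (k * (real n - real k) * radicand) / n" if "k \<le> n"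
  proof -
    have "k * (real n - real k) * radicand = real m * real k * (real n - real k)
        * (2 * \<Delta> * \<delta> * (real n - 2 * real m) + real m * (\<Delta> + \<delta>)\<^sup>2) / (\<Delta> * \<delta>)"
      unfolding radicand_def using that by (simp add: assms(5-7) of_nat_diff mult_ac)
    then show ?thesis using assms(10) by (simp only: real_sqrt_divide) (simp add: mult.commute)
  qed
  have "signless_sum G vs k \<le> bound \<and>
      (signless_sum G vs k = bound \<longleftrightarrow> complete_digraph n G \<and> k = 1)"
    if "1 \<le> k" "k \<le> n - 1"
    using that n signless_sum_le(1)[OF con n, of k] signless_sum_eq_bound_iff[OF con n, of k]
    by (simp add: bound assms(5))
  \<comment> \<open>The factor n - k kills the root, and the full eigenvalue sum is the
    trace.\<close>
  moreover have "signless_sum G vs k = bound \<and> bound = 2 * real m" if "k = n"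
    using that n by (simp add: bound signless_sum_eq sum_qs assms(5))
  ultimately show ?thesis by blast
qed

end
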